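(* Let $\precsim$ be a preorder on $Y$. If $u: Y\to(0,1)$ is a weak-utility for $\precsim$, then the function $d^4_\precsim: Y\times Y\to\mathbb{R}^{+}$ defined by $$d^4_\precsim(x,y)=\begin{cases} \dfrac{u(y)-u(x)}{2}, & x\precsim y,\\[2mm] \dfrac12+\dfrac{u(x)-u(y)}{2}, & y\prec x,\\[2mm] \dfrac12, & \text{otherwise,}\end{cases}$$ is a quasi-pseudo-metric such that $\tau_{d^4_\precsim}$ is finer than $\tau_A^{\precsim}$. Therefore, $\precsim$ is lower $\tau_{d^4_\precsim}$-continuous.
   Context: $\mathbb{R}^+=[0,\infty)$. A preorder is a reflexive transitive relation on a non-empty set; $y\prec x$ means $y\precsim x$ and not $x\precsim y$. A weak-utility for $\precsim$ is an isotonic real-valued function: $x\precsim y$ implies $u(x)\le u(y)$. A quasi-pseudo-metric on $Y$ is a function $q:Y\times Y\to\mathbb{R}^+$ with $q(x,x)=0$ and $q(x,z)\le q(x,y)+q(y,z)$; it induces the topology $\tau_q$ with base the balls $B_q(x,\varepsilon)=\{y\in Y: q(x,y)<\varepsilon\}$, $\varepsilon>0$. The Alexandroff topology $\tau_A^{\precsim}$ consists of all up-sets of $\precsim$, i.e. sets $G\subseteq Y$ such that $x\in G$ and $x\precsim y$ imply $y\in G$. $\precsim$ is lower $\tau$-continuous if $\{x\in Y: x\precsim y\}$ is $\tau$-closed for every $y\in Y$. "$\tau$ finer than $\tau'$" means $\tau'\subseteq\tau$. *)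

theory Defs
  imports "HOL-Analysis.Analysis"
begin

definition strict_part :: "'a rel \<Rightarrow> 'a rel" where
  "strict_part R = {(x, y). (x, y) \<in> R \<and> (y, x) \<notin> R}"

definition weak_utility_on :: "'a set \<Rightarrow> 'a rel \<Rightarrow> ('a \<Rightarrow> real) \<Rightarrow> bool" where
  "weak_utility_on Y R u \<longleftrightarrow> monotone_on Y (\<lambda>x y. (x, y) \<in> R) (\<le>) u"

definition quasi_pseudo_metric_on :: "'a set \<Rightarrow> ('a \<Rightarrow> 'a \<Rightarrow> real) \<Rightarrow> bool" where
  "quasi_pseudo_metric_on Y q \<longleftrightarrow>
     (\<forall>x\<in>Y. \<forall>y\<in>Y. 0 \<le> q x y) \<and>
     (\<forall>x\<in>Y. q x x = 0) \<and>
     (\<forall>x\<in>Y. \<forall>y\<in>Y. \<forall>z\<in>Y. q x z \<le> q x y + q y z)"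

definition qpm_ball :: "'a set \<Rightarrow> ('a \<Rightarrow> 'a \<Rightarrow> real) \<Rightarrow> 'a \<Rightarrow> real \<Rightarrow> 'a set" where
  "qpm_ball Y q x \<epsilon> = {y \<in> Y. q x y < \<epsilon>}"

text \<open>
  The topology having the balls as a base. As with any use of \<^const>\<open>topology\<close>, this is
  meaningful only when the predicate is an \<^const>\<open>istopology\<close>, which holds for every
  quasi-pseudo-metric (see below).
\<close>

definition qpm_topology :: "'a set \<Rightarrow> ('a \<Rightarrow> 'a \<Rightarrow> real) \<Rightarrow> 'a topology" where
  "qpm_topology Y q =
     topology (arbitrary union_of (\<lambda>B. \<exists>x\<in>Y. \<exists>\<epsilon>>0. B = qpm_ball Y q x \<epsilon>))"

definition alexandroff_topology :: "'a set \<Rightarrow> 'a rel \<Rightarrow> 'a topology" where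
  "alexandroff_topology Y R =
     topology (\<lambda>G. G \<subseteq> Y \<and> (\<forall>x\<in>G. \<forall>y\<in>Y. (x, y) \<in> R \<longrightarrow> y \<in> G))"

definition lower_continuous_preorder :: "'a set \<Rightarrow> 'a topology \<Rightarrow> 'a rel \<Rightarrow> bool" where
  "lower_continuous_preorder Y T R \<longleftrightarrow> (\<forall>y\<in>Y. closedin T {x \<in> Y. (x, y) \<in> R})"

definition d4 :: "'a rel \<Rightarrow> ('a \<Rightarrow> real) \<Rightarrow> 'a \<Rightarrow> 'a \<Rightarrow> real" where
  "d4 R u x y =
     (if (x, y) \<in> R then (u y - u x) / 2
      else if (y, x) \<in> strict_part R then 1 / 2 + (u x - u y) / 2
      else 1 / 2)"

lemma istopology_qpm:
  assumes "quasi_pseudo_metric_on Y q"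
  shows "istopology (arbitrary union_of (\<lambda>B. \<exists>x\<in>Y. \<exists>\<epsilon>>0. B = qpm_ball Y q x \<epsilon>))"
proof (subst istopology_base_eq, intro allI impI)
  fix S T
  assume "(\<exists>x\<in>Y. \<exists>\<epsilon>>0. S = qpm_ball Y q x \<epsilon>) \<and> (\<exists>x\<in>Y. \<exists>\<epsilon>>0. T = qpm_ball Y q x \<epsilon>)"
  then obtain a r b s where ab: "a \<in> Y" "b \<in> Y" and S: "S = qpm_ball Y q a r"
    and T: "T = qpm_ball Y q b s"
    by blast
  show "(arbitrary union_of (\<lambda>B. \<exists>x\<in>Y. \<exists>\<epsilon>>0. B = qpm_ball Y q x \<epsilon>)) (S \<inter> T)"
    unfolding arbitrary_union_of_alt
  proof
    fix z assume "z \<in> S \<inter> T"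
    then have z: "z \<in> Y" "q a z < r" "q b z < s"
      by (auto simp: S T qpm_ball_def)
    define e where "e = min (r - q a z) (s - q b z)"
    have e: "e > 0"
      using z by (simp add: e_def)
    have "z \<in> qpm_ball Y q z e"
      using z e assms by (simp add: qpm_ball_def quasi_pseudo_metric_on_def)
    moreover have "qpm_ball Y q z e \<subseteq> S \<inter> T"
    proof
      fix w assume "w \<in> qpm_ball Y q z e"
      then have w: "w \<in> Y" "q z w < e"
        by (auto simp: qpm_ball_def)
      have "q a w \<le> q a z + q z w" "q b w \<le> q b z + q z w"
        using assms ab z w unfolding quasi_pseudo_metric_on_def by blast+
      then show "w \<in> S \<inter> T"
        using w by (auto simp: S T qpm_ball_def e_def)
    qed
    ultimately show "\<exists>U. (\<exists>x\<in>Y. \<exists>\<epsilon>>0. U = qpm_ball Y q x \<epsilon>) \<and> z \<in> U \<and> U \<subseteq> S \<inter> T"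
      using z e by blast
  qed
qed

lemma openin_qpm_topology:
  assumes "quasi_pseudo_metric_on Y q"
  shows "openin (qpm_topology Y q) =
    (arbitrary union_of (\<lambda>B. \<exists>x\<in>Y. \<exists>\<epsilon>>0. B = qpm_ball Y q x \<epsilon>))"
  unfolding qpm_topology_def using istopology_qpm[OF assms] by (rule topology_inverse')

lemma topspace_qpm_topology:
  assumes "quasi_pseudo_metric_on Y q"
  shows "topspace (qpm_topology Y q) = Y"
proof
  show "topspace (qpm_topology Y q) \<subseteq> Y"
    using openin_topspace[of "qpm_topology Y q"]
    by (force simp: openin_qpm_topology[OF assms] arbitrary_union_of_alt qpm_ball_def)
  have "openin (qpm_topology Y q) Y"
    unfolding openin_qpm_topology[OF assms] arbitrary_union_of_alt
  proof
    fix x assume "x \<in> Y"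
    then have "x \<in> qpm_ball Y q x 1" "qpm_ball Y q x 1 \<subseteq> Y"
      using assms by (auto simp: qpm_ball_def quasi_pseudo_metric_on_def)
    then show "\<exists>U. (\<exists>x\<in>Y. \<exists>\<epsilon>>0. U = qpm_ball Y q x \<epsilon>) \<and> x \<in> U \<and> U \<subseteq> Y"
      using \<open>x \<in> Y\<close> zero_less_one by blast
  qed
  then show "Y \<subseteq> topspace (qpm_topology Y q)"
    by (rule openin_subset)
qed

lemma openin_alexandroff_topology:
  "openin (alexandroff_topology Y R) G \<longleftrightarrow>
     G \<subseteq> Y \<and> (\<forall>x\<in>G. \<forall>y\<in>Y. (x, y) \<in> R \<longrightarrow> y \<in> G)"
proof -
  have "istopology (\<lambda>G. G \<subseteq> Y \<and> (\<forall>x\<in>G. \<forall>y\<in>Y. (x, y) \<in> R \<longrightarrow> y \<in> G))"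
    unfolding istopology_def by blast
  then show ?thesis
    by (simp add: alexandroff_topology_def topology_inverse')
qed

lemma topspace_alexandroff_topology: "topspace (alexandroff_topology Y R) = Y"
  by (auto simp: topspace_def openin_alexandroff_topology)

end

theory Submission
  imports Defs
begin

text \<open>
  Since \<open>u\<close> takes values in \<open>(0,1)\<close>, the first case of \<open>d4\<close> gives values below \<open>1/2\<close> and the
  other two give values at least \<open>1/2\<close>. Hence the ball of radius \<open>1/2\<close> around \<open>x\<close> is exactly
  the set of points above \<open>x\<close>, and most cases of the triangle inequality are immediate.
\<close>

lemma d4_less_half_iff:
  assumes "u \<in> Y \<rightarrow> {0<..<1}" "weak_utility_on Y R u" "x \<in> Y" "y \<in> Y"
  shows "d4 R u x y < 1 / 2 \<longleftrightarrow> (x, y) \<in> R"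
proof -
  have "u x > 0" "u y < 1"
    using assms by (auto simp: Pi_iff)
  moreover have "(y, x) \<in> R \<Longrightarrow> u y \<le> u x"
    using assms by (auto simp: weak_utility_on_def monotone_on_def)
  ultimately show ?thesis
    by (auto simp: d4_def strict_part_def)
qed

lemma d4_nonneg:
  assumes "weak_utility_on Y R u" "x \<in> Y" "y \<in> Y"
  shows "0 \<le> d4 R u x y"
proof -
  have "(x, y) \<in> R \<Longrightarrow> u x \<le> u y" "(y, x) \<in> R \<Longrightarrow> u y \<le> u x"
    using assms by (auto simp: weak_utility_on_def monotone_on_def)
  then show ?thesis
    by (auto simp: d4_def strict_part_def)
qed

text \<open>Serves the triangle inequality when neither leg lies in \<open>R\<close>: each leg then
  costs at least 1/2, so a cap of 1 on the direct distance suffices.\<close>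

lemma d4_le_1:
  assumes "u \<in> Y \<rightarrow> {0<..<1}" "x \<in> Y" "y \<in> Y"
  shows "d4 R u x y \<le> 1"
proof -
  have "0 < u x" "u x < 1" "0 < u y" "u y < 1"
    using assms by (auto simp: Pi_iff)
  then show ?thesis
    by (auto simp: d4_def field_simps)
qed

text \<open>The proof splits on which legs lie in \<open>R\<close>. Two related legs telescope to an
  equality. With exactly one related leg, the other costs at least 1/2, so only a direct distance
  above 1/2 needs work, which forces \<open>z\<close> strictly below \<open>x\<close>.\<close>

lemma d4_triangle:
  assumes "trans R" and u: "u \<in> Y \<rightarrow> {0<..<1}" "weak_utility_on Y R u"
    and Y: "x \<in> Y" "y \<in> Y" "z \<in> Y"
  shows "d4 R u x z \<le> d4 R u x y + d4 R u y z"
proof -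
  have mono: "u a \<le> u b" if "(a, b) \<in> R" "a \<in> Y" "b \<in> Y" for a b
    using u(2) that by (auto simp: weak_utility_on_def monotone_on_def)
  have trans: "(a, c) \<in> R" if "(a, b) \<in> R" "(b, c) \<in> R" for a b c
    using \<open>trans R\<close> that by (rule transD)
  note half = d4_less_half_iff[OF u]
  note nonneg = d4_nonneg[OF u(2)]
  consider "(x, y) \<in> R" "(y, z) \<in> R" | "(x, y) \<notin> R" "(y, z) \<notin> R"
    | "(x, y) \<in> R" "(y, z) \<notin> R" | "(x, y) \<notin> R" "(y, z) \<in> R"
    by blast
  then show ?thesis
  proof cases
    case 1
    then show ?thesis
      using trans[OF 1] by (simp add: d4_def field_simps)
  next
    case 2
    then show ?thesis
      using half[of x y] half[of y z] d4_le_1[OF u(1), of x z R] Y by force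
  next
    case 3
    show ?thesis
    proof (cases "(z, x) \<in> strict_part R")
      case True
      \<comment> \<open>The chain z, x, y is increasing and \<open>(y, z)\<close> is not in
        \<open>R\<close>, so the unrelated leg is also a strict descent. Its cost 1/2 + (u y - u
        z)/2 reduces the claim to u x \<le> u y.\<close>
      then have "(z, y) \<in> strict_part R" "(x, z) \<notin> R"
        using 3 trans by (auto simp: strict_part_def)
      then show ?thesis
        using True 3 mono[of x y] Y by (auto simp: d4_def field_simps)
    next
      case False
      then have "d4 R u x z \<le> 1 / 2"
        using half[of x z] Y by (auto simp: d4_def)
      then show ?thesis
        using half[of y z] nonneg[of x y] 3 Y by force
    qed
  next
    case 4
    show ?thesis
    proof (cases "(z, x) \<in> strict_part R")
      case True
      \<comment> \<open>Mirror image: the chain y, z, x is increasing, the first leg is the strict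
        descent, and the claim reduces to u y \<le> u z.\<close>
      then have "(y, x) \<in> strict_part R" "(x, z) \<notin> R"
        using 4 trans by (auto simp: strict_part_def)
      then show ?thesis
        using True 4 mono[of y z] Y by (auto simp: d4_def field_simps)
    next
      case False
      then have "d4 R u x z \<le> 1 / 2"
        using half[of x z] Y by (auto simp: d4_def)
      then show ?thesis
        using half[of x y] nonneg[of y z] 4 Y by force
    qed
  qed
qed

lemma quasi_pseudo_metric_on_d4:
  assumes "preorder_on Y R" "u \<in> Y \<rightarrow> {0<..<1}" "weak_utility_on Y R u"
  shows "quasi_pseudo_metric_on Y (d4 R u)"
proof -
  have "refl_on Y R" "trans R"
    using assms(1) by (auto simp: preorder_on_def)
  then have "d4 R u x x = 0" if "x \<in> Y" for x
    using that by (auto simp: d4_def refl_on_def)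
  then show ?thesis
    using d4_nonneg[OF assms(3)] d4_triangle[OF \<open>trans R\<close> assms(2,3)]
    by (simp add: quasi_pseudo_metric_on_def)
qed

lemma openin_qpm_topology_d4:
  assumes "preorder_on Y R" "u \<in> Y \<rightarrow> {0<..<1}" "weak_utility_on Y R u"
    and "openin (alexandroff_topology Y R) G"
  shows "openin (qpm_topology Y (d4 R u)) G"
  unfolding openin_qpm_topology[OF quasi_pseudo_metric_on_d4[OF assms(1-3)]]
    arbitrary_union_of_alt
proof
  fix x assume "x \<in> G"
  have G: "G \<subseteq> Y" "\<And>x y. x \<in> G \<Longrightarrow> y \<in> Y \<Longrightarrow> (x, y) \<in> R \<Longrightarrow> y \<in> G"
    using assms(4) by (auto simp: openin_alexandroff_topology)
  have x: "x \<in> Y" "(x, x) \<in> R"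
    using \<open>x \<in> G\<close> G(1) assms(1) by (auto simp: preorder_on_def refl_on_def)
  \<comment> \<open>This ball is the least up-set containing \<open>x\<close>, so it fits inside
    every up-set around \<open>x\<close>; one radius works for all points.\<close>
  have "qpm_ball Y (d4 R u) x (1 / 2) = {y \<in> Y. (x, y) \<in> R}"
    using x(1) d4_less_half_iff[OF assms(2,3)] by (auto simp: qpm_ball_def)
  then have "x \<in> qpm_ball Y (d4 R u) x (1 / 2)" "qpm_ball Y (d4 R u) x (1 / 2) \<subseteq> G"
    using x G(2)[OF \<open>x \<in> G\<close>] by auto
  moreover have "(1 / 2 :: real) > 0"
    by simp
  ultimately show "\<exists>U. (\<exists>x\<in>Y. \<exists>\<epsilon>>0. U = qpm_ball Y (d4 R u) x \<epsilon>) \<and> x \<in> U \<and> U \<subseteq> G"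
    using x(1) by blast
qed

theorem theorem25:
  fixes Y :: "'a set" and R :: "'a rel" and u :: "'a \<Rightarrow> real"
  assumes "Y \<noteq> {}"
    and "preorder_on Y R"
    and "u \<in> Y \<rightarrow> {0<..<1}"
    and "weak_utility_on Y R u"
  shows "quasi_pseudo_metric_on Y (d4 R u) \<and>
    (\<forall>G. openin (alexandroff_topology Y R) G \<longrightarrow> openin (qpm_topology Y (d4 R u)) G) \<and>
    lower_continuous_preorder Y (qpm_topology Y (d4 R u)) R"
proof (intro conjI allI impI)
  show qpm: "quasi_pseudo_metric_on Y (d4 R u)"
    using assms(2-4) by (rule quasi_pseudo_metric_on_d4)
  show finer: "openin (qpm_topology Y (d4 R u)) G" if "openin (alexandroff_topology Y R) G" for G
    using assms(2-4) that by (rule openin_qpm_topology_d4)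
  show "lower_continuous_preorder Y (qpm_topology Y (d4 R u)) R"
    unfolding lower_continuous_preorder_def closedin_def topspace_qpm_topology[OF qpm]
  proof (intro ballI conjI)
    fix y assume "y \<in> Y"
    have "trans R"
      using assms(2) by (simp add: preorder_on_def)
    \<comment> \<open>By transitivity the points below \<open>y\<close> form a down-set, so their
      complement is an up-set and hence already Alexandroff open.\<close>
    then show "openin (qpm_topology Y (d4 R u)) (Y - {x \<in> Y. (x, y) \<in> R})"
      by (intro finer) (auto simp: openin_alexandroff_topology dest: transD)
  qed auto
qed

end
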